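(* For every fixed positive integer $k$, there exist $k$-unbalanced digraphs of arbitrarily large chromatic number.
   Context: A digraph is a pair $\mathcal{G}=(V,E)$ with $E\subseteq V^2$ and no edge of the form $(v,v)$; its chromatic number is the least $\chi$ (possibly infinite) such that some map $c:V\to[\chi]$ has $c(a)\ne c(b)$ for all $(a,b)\in E$. A cycle of $\mathcal{G}$ is a closed walk $c=(v_0,e_1,v_1,\dots,e_n,v_n)$ with $v_n=v_0$, $e_i\in E$ and $\{v_{i-1},v_i\}$ the endpoints of $e_i$; step $i$ is a forward edge if $e_i=(v_{i-1},v_i)$ and a backward edge otherwise. $\mathcal{G}$ is $k$-unbalanced if for every cycle $c$ of $\mathcal{G}$, either $c$ has exactly as many forward edges as backward edges, or there are two non-overlapping contiguous stretches of $c$ (each consisting of consecutive steps of $c$) such that one stretch has at least $k$ more forward edges than backward edges and the other has at least $k$ fewer forward edges than backward edges. *)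

theory Defs
  imports "Graph_Theory.Pair_Digraph" "HOL-Library.Extended_Nat"
begin

definition proper_colouring :: "'a pair_pre_digraph \<Rightarrow> nat \<Rightarrow> ('a \<Rightarrow> nat) \<Rightarrow> bool" where
  "proper_colouring G n c \<longleftrightarrow>
     c ` pverts G \<subseteq> {1..n} \<and> (\<forall>(a, b) \<in> parcs G. c a \<noteq> c b)"

text \<open>In \<^typ>\<open>enat\<close> the infimum of the empty set is \<open>\<infinity>\<close>, and a nonempty set
  contains its infimum.\<close>

definition chromatic_number :: "'a pair_pre_digraph \<Rightarrow> enat" where
  "chromatic_number G = Inf {enat n | n. \<exists>c. proper_colouring G n c}"

text \<open>A walk \<open>(v\<^sub>0, e\<^sub>1, v\<^sub>1, \<dots>, e\<^sub>n, v\<^sub>n)\<close> is given by the list \<open>vs\<close> of its \<open>n + 1\<close> vertices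
  and the list \<open>es\<close> of its \<open>n\<close> edges, which may be traversed in either direction. The step
  using \<open>es ! i\<close> goes from \<open>vs ! i\<close> to \<open>vs ! Suc i\<close>, so the steps are
  numbered from \<open>0\<close>.\<close>

definition oriented_cycle :: "'a pair_pre_digraph \<Rightarrow> 'a list \<Rightarrow> ('a \<times> 'a) list \<Rightarrow> bool" where
  "oriented_cycle G vs es \<longleftrightarrow>
     length vs = Suc (length es) \<and> set vs \<subseteq> pverts G \<and> last vs = hd vs \<and>
     (\<forall>i < length es. es ! i \<in> parcs G \<and> {vs ! i, vs ! Suc i} = {fst (es ! i), snd (es ! i)})"

definition forward_step :: "'a list \<Rightarrow> ('a \<times> 'a) list \<Rightarrow> nat \<Rightarrow> bool" where
  "forward_step vs es i \<longleftrightarrow> es ! i = (vs ! i, vs ! Suc i)"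

definition num_forward :: "'a list \<Rightarrow> ('a \<times> 'a) list \<Rightarrow> nat set \<Rightarrow> nat" where
  "num_forward vs es I = card {i \<in> I. forward_step vs es i}"

definition num_backward :: "'a list \<Rightarrow> ('a \<times> 'a) list \<Rightarrow> nat set \<Rightarrow> nat" where
  "num_backward vs es I = card {i \<in> I. \<not> forward_step vs es i}"

text \<open>A stretch is an interval of steps of the walk as listed; it does not wrap around from the
  last step to the first. The two stretches may occur in either order.\<close>

definition stretch :: "('a \<times> 'a) list \<Rightarrow> nat set \<Rightarrow> bool" where
  "stretch es I \<longleftrightarrow> (\<exists>a b. b \<le> length es \<and> I = {a..<b})"

definition unbalanced :: "nat \<Rightarrow> 'a pair_pre_digraph \<Rightarrow> bool" where
  "unbalanced k G \<longleftrightarrow>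
     (\<forall>vs es. oriented_cycle G vs es \<longrightarrow>
        num_forward vs es {..<length es} = num_backward vs es {..<length es} \<or>
        (\<exists>I J. stretch es I \<and> stretch es J \<and> I \<inter> J = {} \<and>
           num_forward vs es I \<ge> num_backward vs es I + k \<and>
           num_forward vs es J + k \<le> num_backward vs es J))"

end

theory Submission
  imports Defs "HOL-Library.Ramsey" "HOL-Library.Nat_Bijection"
begin

text \<open>
  Take the shift graph on increasing \<open>4k\<close>-tuples of naturals, where
  \<open>(a\<^sub>0, \<dots>, a\<^bsub>r-1\<^esub>) \<rightarrow> (a\<^sub>1, \<dots>, a\<^sub>r)\<close>. By Ramsey's theorem, it has no finite proper colouring.
  A walk in it is a window of width \<open>r\<close> moving along an increasing sequence, one place to the right
  for a forward step and one to the left for a backward step; an entry of the sequence can only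
  change while it is out of the window. If a walk of net length \<open>d > 0\<close> never falls by \<open>2k\<close>, the
  window never loses sight of the entry at the rightmost position reached so far, so that this
  entry strictly increases, and the walk is not closed. So a closed walk with \<open>d > 0\<close> has a stretch
  with a fall of at least \<open>2k\<close>; the part before and the part after it together rise by more than
  \<open>2k\<close>, so one of them rises by at least \<open>k\<close>. Reversal of the walk deals with \<open>d < 0\<close>.
\<close>

section \<open>Shift graphs and their chromatic number\<close>

definition increasing_tuples :: "nat \<Rightarrow> nat list set" where
  "increasing_tuples r = {xs. length xs = r \<and> sorted_wrt (<) xs}"

definition shifts_to :: "nat list \<Rightarrow> nat list \<Rightarrow> bool" where
  "shifts_to xs ys \<longleftrightarrow> (\<forall>i. Suc i < length xs \<longrightarrow> ys ! i = xs ! Suc i)"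

text \<open>\<open>list_encode\<close> turns tuples into natural numbers, the vertex type of the
  theorem.\<close>

definition shift_graph :: "nat \<Rightarrow> nat pair_pre_digraph" where
  "shift_graph r =
     \<lparr> pverts = list_encode ` increasing_tuples r,
       parcs = {(list_encode xs, list_encode ys) | xs ys.
                  xs \<in> increasing_tuples r \<and> ys \<in> increasing_tuples r \<and> shifts_to xs ys} \<rparr>"

lemma shifts_toD: "shifts_to xs ys \<Longrightarrow> Suc i < length xs \<Longrightarrow> ys ! i = xs ! Suc i"
  by (simp add: shifts_to_def)

lemma shift_graph_arcD:
  assumes "(u, v) \<in> parcs (shift_graph r)"
  shows "shifts_to (list_decode u) (list_decode v)"
  using assms by (auto simp: shift_graph_def)

text \<open>Along an arc the first entry grows. For \<open>r\<close> below 2,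
  \<open>shifts_to\<close> is vacuous and every vertex carries a loop.\<close>

lemma pair_loopfree_shift_graph:
  assumes "r \<ge> 2"
  shows "pair_loopfree_digraph (shift_graph r)"
proof
  fix e assume e: "e \<in> parcs (shift_graph r)"
  then obtain xs ys where xy: "e = (list_encode xs, list_encode ys)"
    "xs \<in> increasing_tuples r" "ys \<in> increasing_tuples r" "shifts_to xs ys"
    by (auto simp: shift_graph_def)
  then show "fst e \<in> pverts (shift_graph r)" "snd e \<in> pverts (shift_graph r)"
    by (auto simp: shift_graph_def)
  have "xs ! 0 < xs ! 1"
    using xy assms by (auto simp: increasing_tuples_def sorted_wrt_iff_nth_less)
  moreover have "ys ! 0 = xs ! 1"
    using xy assms by (auto simp: increasing_tuples_def shifts_to_def)
  ultimately show "fst e \<noteq> snd e"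
    using xy by (auto simp: list_encode_eq)
qed

text \<open>A colouring of the vertices colours the \<open>r\<close>-subsets of the naturals. On an
  infinite homogeneous set, two consecutive windows of the enumeration form an arc with equal
  colours.\<close>

lemma shift_graph_not_colourable: "\<not> proper_colouring (shift_graph r) n c"
proof
  assume c: "proper_colouring (shift_graph r) n c"
  define f where "f X = c (list_encode (sorted_list_of_set X))" for X :: "nat set"
  have "f X < Suc n" if "finite X" "card X = r" for X
  proof -
    have "sorted_list_of_set X \<in> increasing_tuples r"
      using that by (simp add: increasing_tuples_def)
    then have "f X \<in> c ` pverts (shift_graph r)"
      by (auto simp: f_def shift_graph_def)
    with c show ?thesis
      by (auto simp: proper_colouring_def)
  qed
  then obtain Y t where Y: "infinite Y" and t: "\<And>X. X \<subseteq> Y \<Longrightarrow> finite X \<Longrightarrow> card X = r \<Longrightarrow> f X = t"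
    using Ramsey[of "UNIV :: nat set" r f "Suc n"] by auto
  define xs where "xs m = map (enumerate Y) [m..<m + r]" for m
  have mono: "enumerate Y i < enumerate Y j" if "i < j" for i j
    using that Y by (simp add: enumerate_mono)
  have incr: "xs m \<in> increasing_tuples r" for m
    by (auto simp: xs_def increasing_tuples_def sorted_wrt_iff_nth_less mono)
  have col: "c (list_encode (xs m)) = t" for m
  proof -
    have s: "sorted_wrt (<) (xs m)" "length (xs m) = r"
      using incr by (auto simp: increasing_tuples_def)
    then have "sorted (xs m)" "distinct (xs m)"
      by (auto simp: strict_sorted_iff)
    then have "sorted_list_of_set (set (xs m)) = xs m" "card (set (xs m)) = r"
      using s by (auto simp: sorted_list_of_set.idem_if_sorted_distinct distinct_card)
    moreover have "set (xs m) \<subseteq> Y"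
      using Y by (auto simp: xs_def enumerate_in_set)
    ultimately show ?thesis
      using t[of "set (xs m)"] by (simp add: f_def)
  qed
  have "shifts_to (xs 0) (xs 1)"
    by (auto simp: shifts_to_def xs_def simp del: upt_Suc)
  then have "(list_encode (xs 0), list_encode (xs 1)) \<in> parcs (shift_graph r)"
    using incr by (auto simp: shift_graph_def)
  with c have "c (list_encode (xs 0)) \<noteq> c (list_encode (xs 1))"
    by (auto simp: proper_colouring_def)
  then show False
    by (simp add: col)
qed

lemma chromatic_number_shift_graph: "chromatic_number (shift_graph r) = \<infinity>"
  by (simp add: chromatic_number_def shift_graph_not_colourable top_enat_def)

section \<open>Closed walks as moving windows\<close>

definition shift_step :: "nat list \<Rightarrow> int \<Rightarrow> nat list \<Rightarrow> int \<Rightarrow> bool" where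
  "shift_step xs h ys h' \<longleftrightarrow>
     (h' = h + 1 \<and> shifts_to xs ys) \<or> (h' = h - 1 \<and> shifts_to ys xs)"

text \<open>Entry \<open>w i ! j\<close> occupies position \<open>H i + j\<close>. Without a fall of
  \<open>K\<close>, the entry at a nondecreasing position \<open>p i\<close> stays in view and grows
  whenever \<open>p i\<close> does, whereas closedness would restore its first value.\<close>

lemma closed_shift_walk_falls:
  fixes w :: "nat \<Rightarrow> nat list" and H :: "nat \<Rightarrow> int"
  assumes tuples: "\<And>i. i \<le> n \<Longrightarrow> w i \<in> increasing_tuples (2 * K)"
    and steps: "\<And>i. i < n \<Longrightarrow> shift_step (w i) (H i) (w (Suc i)) (H (Suc i))"
    and closed: "w n = w 0"
    and rise: "H 0 < H n"
  shows "\<exists>s t. s \<le> t \<and> t \<le> n \<and> H t + int K \<le> H s"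
proof (rule ccontr)
  assume "\<not> ?thesis"
  then have no_fall: "H s < H t + int K" if "s \<le> t" "t \<le> n" for s t
    using that by (meson not_le)
  define top where "top i = Max (H ` {..i})" for i
  have top_0: "top 0 = H 0"
    by (simp add: top_def)
  have top_Suc: "top (Suc i) = max (top i) (H (Suc i))" for i
    by (simp add: top_def atMost_Suc max.commute)
  have top_ge: "H s \<le> top i" if "s \<le> i" for s i
    using that by (simp add: top_def)
  have top_less: "top i < H i + int K" if "i \<le> n" for i
  proof -
    have "top i \<in> H ` {..i}"
      unfolding top_def by (intro Max_in) auto
    with no_fall that show ?thesis by auto
  qed
  \<comment> \<open>With this start \<open>c\<close>, the offset in the window of the tracked position \<open>p\<close> is the same at
    times \<open>0\<close> and \<open>n\<close>.\<close>
  define c where "c = H 0 + (top n - H n)"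
  define p where "p i = max c (top i)" for i
  define off where "off i = nat (p i - H i)" for i
  have c: "H 0 \<le> c" "c < H 0 + int K"
    using top_ge[of n n] top_less[of n] by (auto simp: c_def)
  have off: "int (off i) = p i - H i" "off i + 1 < 2 * K" if "i \<le> n" for i
  proof -
    have "H i \<le> p i" using top_ge[of i i] by (simp add: p_def)
    then show "int (off i) = p i - H i" by (simp add: off_def)
    \<comment> \<open>\<open>c - H i\<close> is the sum of \<open>c - H 0\<close> and
      \<open>H 0 - H i\<close>, each at most \<open>K - 1\<close>; \<open>top i - H i\<close> is at
      most \<open>K - 1\<close> as well.\<close>
    have "p i - H i + 1 < 2 * int K"
      using no_fall[of 0 i] c top_less[OF that] top_less[of 0] that unfolding p_def by auto
    then show "off i + 1 < 2 * K" using \<open>H i \<le> p i\<close> by (auto simp: off_def)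
  qed
  have len: "length (w i) = 2 * K" if "i \<le> n" for i
    using tuples that by (auto simp: increasing_tuples_def)
  have grow: "int (w 0 ! off 0) + (p i - p 0) \<le> int (w i ! off i)" if "i \<le> n" for i
    using that
  proof (induction i)
    case 0
    then show ?case by simp
  next
    case (Suc i)
    then have i: "i < n" "i \<le> n" "Suc i \<le> n" by auto
    note IH = Suc.IH[OF i(2)]
    note o = off[OF i(2)] off[OF i(3)]
    have p_Suc: "p (Suc i) = max (p i) (H (Suc i))"
      by (simp add: p_def top_Suc)
    have ge: "H i \<le> p i" using o by linarith
    from steps[OF i(1)] show ?case
      unfolding shift_step_def
    proof (elim disjE conjE)
      assume h: "H (Suc i) = H i + 1" and sh: "shifts_to (w i) (w (Suc i))"
      show ?case
      proof (cases "H i = p i")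
        \<comment> \<open>The tracked entry leaves the window on the left, so tracking passes to its
          larger right neighbour.\<close>
        case True
        then have "p (Suc i) = p i + 1" "off i = 0" "off (Suc i) = 0"
          using p_Suc h o by auto
        moreover have "w (Suc i) ! 0 = w i ! 1"
          using shifts_toD[OF sh, of 0] len[OF i(2)] o by simp
        moreover have "w i ! 0 < w i ! 1"
          using tuples[OF i(2)] o by (auto simp: increasing_tuples_def sorted_wrt_iff_nth_less)
        ultimately show ?thesis using IH by simp
      next
        case False
        then have "p (Suc i) = p i" "off i = Suc (off (Suc i))"
          using p_Suc h o ge by auto
        moreover have "w (Suc i) ! off (Suc i) = w i ! Suc (off (Suc i))"
          using shifts_toD[OF sh] len[OF i(2)] o by simp
        ultimately show ?thesis using IH by simp
      qed
    next
      assume h: "H (Suc i) = H i - 1" and sh: "shifts_to (w (Suc i)) (w i)"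
      then have "p (Suc i) = p i" "off (Suc i) = Suc (off i)"
        using p_Suc o ge by auto
      moreover have "w i ! off i = w (Suc i) ! Suc (off i)"
        using shifts_toD[OF sh] len[OF i(3)] o by simp
      ultimately show ?case using IH by simp
    qed
  qed
  have "p 0 = c" "p n = top n"
    using c rise by (auto simp: p_def top_0 c_def)
  \<comment> \<open>Here \<open>p n - p 0 = H n - H 0\<close>. Equal offsets in equal tuples give
    equal entries, against \<open>grow\<close>.\<close>
  then have "off n = off 0" "p 0 < p n"
    using rise by (auto simp: off_def c_def)
  with grow[of n] closed show False
    by simp
qed

text \<open>Reversing time preserves \<open>shift_step\<close> and turns falls into rises.\<close>

lemma closed_shift_walk_rises:
  fixes w :: "nat \<Rightarrow> nat list" and H :: "nat \<Rightarrow> int"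
  assumes tuples: "\<And>i. i \<le> n \<Longrightarrow> w i \<in> increasing_tuples (2 * K)"
    and steps: "\<And>i. i < n \<Longrightarrow> shift_step (w i) (H i) (w (Suc i)) (H (Suc i))"
    and closed: "w n = w 0"
    and fall: "H n < H 0"
  shows "\<exists>s t. s \<le> t \<and> t \<le> n \<and> H s + int K \<le> H t"
proof -
  have "shift_step (w (n - i)) (H (n - i)) (w (n - Suc i)) (H (n - Suc i))" if "i < n" for i
    using steps[of "n - Suc i"] that by (auto simp: shift_step_def Suc_diff_Suc)
  then obtain s t where "s \<le> t" "t \<le> n" "H (n - t) + int K \<le> H (n - s)"
    using closed_shift_walk_falls[of n "\<lambda>i. w (n - i)" K "\<lambda>i. H (n - i)"] tuples closed fall
    by auto
  then show ?thesis
    by (intro exI[of _ "n - t"] exI[of _ "n - s"]) auto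
qed

section \<open>Heights and stretches of a cycle\<close>

definition height :: "'a list \<Rightarrow> ('a \<times> 'a) list \<Rightarrow> nat \<Rightarrow> int" where
  "height vs es i = int (num_forward vs es {..<i}) - int (num_backward vs es {..<i})"

lemma height_0 [simp]: "height vs es 0 = 0"
  by (simp add: height_def num_forward_def num_backward_def)

lemma height_Suc:
  "height vs es (Suc i) = height vs es i + (if forward_step vs es i then 1 else - 1)"
proof -
  have "{j \<in> {..<Suc i}. P j} = (if P i then insert i {j \<in> {..<i}. P j} else {j \<in> {..<i}. P j})"
    for P by (auto simp: less_Suc_eq)
  then show ?thesis
    by (simp add: height_def num_forward_def num_backward_def)
qed

lemma height_diff:
  assumes "a \<le> b"
  shows "height vs es b - height vs es a =
    int (num_forward vs es {a..<b}) - int (num_backward vs es {a..<b})"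
proof -
  have split: "{j \<in> {..<b}. P j} = {j \<in> {..<a}. P j} \<union> {j \<in> {a..<b}. P j}" for P
    using assms by auto
  have "card {j \<in> {..<b}. P j} = card {j \<in> {..<a}. P j} + card {j \<in> {a..<b}. P j}" for P
    unfolding split by (intro card_Un_disjoint) auto
  then show ?thesis
    by (simp add: height_def num_forward_def num_backward_def)
qed

text \<open>The excess of forward steps in a stretch is the difference of the heights at its ends.
  The rise may precede or follow the fall.\<close>

lemma opposite_stretches:
  assumes "a \<le> b" "b \<le> length es" "a' \<le> b'" "b' \<le> length es" "b \<le> a' \<or> b' \<le> a"
    and "height vs es a + int k \<le> height vs es b" "height vs es b' + int k \<le> height vs es a'"
  shows "\<exists>I J. stretch es I \<and> stretch es J \<and> I \<inter> J = {} \<and>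
           num_forward vs es I \<ge> num_backward vs es I + k \<and>
           num_forward vs es J + k \<le> num_backward vs es J"
proof (intro exI conjI)
  show "stretch es {a..<b}" "stretch es {a'..<b'}"
    using assms unfolding stretch_def by blast+
  show "{a..<b} \<inter> {a'..<b'} = {}"
    using assms by auto
  show "num_forward vs es {a..<b} \<ge> num_backward vs es {a..<b} + k"
    "num_forward vs es {a'..<b'} + k \<le> num_backward vs es {a'..<b'}"
    using assms height_diff[of a b vs es] height_diff[of a' b' vs es] by linarith+
qed

lemma unbalanced_shift_graph: "unbalanced k (shift_graph (4 * k))"
  unfolding unbalanced_def
proof (intro allI impI)
  fix vs :: "nat list" and es
  assume cyc: "oriented_cycle (shift_graph (4 * k)) vs es"
  define n where "n = length es"
  define H where "H = height vs es"
  define w where "w i = list_decode (vs ! i)" for i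
  have len: "length vs = Suc n" and verts: "set vs \<subseteq> pverts (shift_graph (4 * k))"
    and last: "last vs = hd vs"
    and arcs: "\<And>i. i < n \<Longrightarrow> es ! i \<in> parcs (shift_graph (4 * k))"
    and ends: "\<And>i. i < n \<Longrightarrow> {vs ! i, vs ! Suc i} = {fst (es ! i), snd (es ! i)}"
    using cyc by (auto simp: oriented_cycle_def n_def)
  have tuples: "w i \<in> increasing_tuples (2 * (2 * k))" if "i \<le> n" for i
  proof -
    have "vs ! i \<in> pverts (shift_graph (4 * k))"
      using that len verts by (auto simp: subset_iff)
    then show ?thesis
      by (auto simp: shift_graph_def w_def)
  qed
  have closed: "w n = w 0"
    using last len last_conv_nth[of vs] hd_conv_nth[of vs] by (cases "vs = []") (auto simp: w_def)
  have steps: "shift_step (w i) (H i) (w (Suc i)) (H (Suc i))" if i: "i < n" for i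
  proof (cases "forward_step vs es i")
    case True
    then have "shifts_to (w i) (w (Suc i))"
      using shift_graph_arcD arcs[OF i] by (simp add: forward_step_def w_def)
    then show ?thesis
      using True by (simp add: shift_step_def H_def height_Suc)
  next
    case False
    then have "es ! i = (vs ! Suc i, vs ! i)"
      using ends[OF i] by (auto simp: forward_step_def doubleton_eq_iff prod_eq_iff)
    then have "shifts_to (w (Suc i)) (w i)"
      using shift_graph_arcD arcs[OF i] by (simp add: w_def)
    then show ?thesis
      using False by (simp add: shift_step_def H_def height_Suc)
  qed
  have H_0: "H 0 = 0"
    by (simp add: H_def)
  consider "H n = 0" | "H n > 0" | "H n < 0" by linarith
  then show "num_forward vs es {..<length es} = num_backward vs es {..<length es} \<or>
        (\<exists>I J. stretch es I \<and> stretch es J \<and> I \<inter> J = {} \<and>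
           num_forward vs es I \<ge> num_backward vs es I + k \<and>
           num_forward vs es J + k \<le> num_backward vs es J)"
  proof cases
    case 1
    then show ?thesis by (simp add: H_def height_def n_def)
  next
    case 2
    then obtain s t where st: "s \<le> t" "t \<le> n" "H t + int (2 * k) \<le> H s"
      using closed_shift_walk_falls[OF tuples steps closed] H_0 by auto
    \<comment> \<open>The two outer rises \<open>H s - H 0\<close> and \<open>H n - H t\<close> add
      up to \<open>H n + (H s - H t)\<close>, which exceeds \<open>2 * k\<close>.\<close>
    then have "H 0 + int k \<le> H s \<or> H t + int k \<le> H n"
      using 2 H_0 by linarith
    then show ?thesis
      using st opposite_stretches[of 0 s es s t vs k] opposite_stretches[of t n es s t vs k]
      by (auto simp: H_def n_def)
  next
    case 3
    then obtain s t where st: "s \<le> t" "t \<le> n" "H s + int (2 * k) \<le> H t"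
      using closed_shift_walk_rises[OF tuples steps closed] H_0 by auto
    then have "H s + int k \<le> H 0 \<or> H n + int k \<le> H t"
      using 3 H_0 by linarith
    then show ?thesis
      using st opposite_stretches[of s t es 0 s vs k] opposite_stretches[of s t es t n vs k]
      by (auto simp: H_def n_def)
  qed
qed

theorem theorem8:
  fixes k :: nat
  assumes "k \<ge> 1"
  shows "\<forall>N :: nat. \<exists>G :: nat pair_pre_digraph.
           pair_loopfree_digraph G \<and> unbalanced k G \<and> chromatic_number G \<ge> enat N"
proof
  fix N :: nat
  show "\<exists>G :: nat pair_pre_digraph.
           pair_loopfree_digraph G \<and> unbalanced k G \<and> chromatic_number G \<ge> enat N"
    \<comment> \<open>As \<open>k\<close> is positive, the width \<open>4 * k\<close> is at least 2,
      which excludes loops.\<close>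
    using assms pair_loopfree_shift_graph[of "4 * k"] unbalanced_shift_graph[of k]
    by (intro exI[of _ "shift_graph (4 * k)"]) (simp add: chromatic_number_shift_graph)
qed

end
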